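(* Let $\{P_n(x)\}_{n\ge 1}$ be the sequence defined in the context. For every $n\ge 1$, $P_n(x)$ is a polynomial in $x$ of degree $\lfloor\frac{n-1}{2}\rfloor$ with integer coefficients.
   Context: The sequence $\{P_n(x)\}_{n\ge1}$ of rational functions of $x$ is defined by $P_1=P_2=1$ and, for $n\ge 2$: if $n$ is odd, $4(2x+n)P_{n+1}(x)=2(x+n)P_n(x)+(2x+n)P_n(x+1)+(4x+n)\ell_n(x)$; if $n$ is even, $4P_{n+1}(x)=4(x+n)P_n(x)+2(2x+n+1)P_n(x+1)+(4x+n)\ell_{n-1}(x)$. Here for odd $r\ge1$, $\ell_r(x)=\prod_{j=1}^{(r-1)/2}(x+j)$ (the empty product equals $1$). *)

theory Defs
  imports "HOL-Computational_Algebra.Computational_Algebra"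
begin

text \<open>
  Rational functions in one variable over a field \<open>'a\<close> of characteristic 0 are elements of
  \<open>'a poly fract\<close>, the fraction field of \<open>'a[x]\<close>.
\<close>

type_synonym 'a ratfun = "'a poly fract"

definition ratfun_X :: "'a :: field_char_0 ratfun" where
  "ratfun_X = to_fract [:0, 1:]"

lemma pcompose_shift_eq_0_iff:
  fixes p :: "'a :: field_char_0 poly"
  shows "pcompose p [:1, 1:] = 0 \<longleftrightarrow> p = 0"
  by (auto dest: pcompose_eq_0)

text \<open>
  The substitution \<open>x \<mapsto> x + 1\<close> on rational functions, induced by
  \<open>a/b \<mapsto> a(x + 1)/b(x + 1)\<close> on representatives.
\<close>

definition ratfun_shift :: "'a :: field_char_0 ratfun \<Rightarrow> 'a ratfun" where
  "ratfun_shift q = (THE r. \<exists>a b. b \<noteq> 0 \<and> q = Fract a b \<and>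
     r = Fract (pcompose a [:1, 1:]) (pcompose b [:1, 1:]))"

lemma ratfun_shift_Fract:
  fixes a b :: "'a :: field_char_0 poly"
  assumes "b \<noteq> 0"
  shows "ratfun_shift (Fract a b) = Fract (pcompose a [:1, 1:]) (pcompose b [:1, 1:])"
  unfolding ratfun_shift_def
proof (rule the_equality)
  show "\<exists>a' b'. b' \<noteq> 0 \<and> Fract a b = Fract a' b' \<and>
      Fract (pcompose a [:1, 1:]) (pcompose b [:1, 1:])
        = Fract (pcompose a' [:1, 1:]) (pcompose b' [:1, 1:])"
    using assms by blast
next
  fix r
  assume "\<exists>a' b'. b' \<noteq> 0 \<and> Fract a b = Fract a' b' \<and>
    r = Fract (pcompose a' [:1, 1:]) (pcompose b' [:1, 1:])"
  then obtain a' b' where b': "b' \<noteq> 0" and eq: "Fract a b = Fract a' b'"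
    and r: "r = Fract (pcompose a' [:1, 1:]) (pcompose b' [:1, 1:])"
    by blast
  from eq assms b' have "a * b' = a' * b"
    by (simp add: eq_fract)
  then have "pcompose a [:1, 1:] * pcompose b' [:1, 1:] = pcompose a' [:1, 1:] * pcompose b [:1, 1:]"
    by (simp flip: pcompose_mult)
  then show "r = Fract (pcompose a [:1, 1:]) (pcompose b [:1, 1:])"
    using assms b' by (simp add: r eq_fract pcompose_shift_eq_0_iff)
qed

lemma ratfun_shift_to_fract:
  "ratfun_shift (to_fract p) = to_fract (pcompose p [:1, 1:])"
  by (simp add: to_fract_def ratfun_shift_Fract pcompose_1)

text \<open>Only odd \<open>r\<close> matter.\<close>

definition ell :: "nat \<Rightarrow> 'a :: field_char_0 ratfun" where
  "ell r = (\<Prod>j = 1..(r - 1) div 2. ratfun_X + of_nat j)"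

text \<open>
  The sequence starts at index 1; the value at 0 is a dummy.  The recurrences are solved for the
  next term here, and are recovered in their original form below.
\<close>

primrec P_seq :: "nat \<Rightarrow> 'a :: field_char_0 ratfun" where
  "P_seq 0 = 0"
| "P_seq (Suc n) =
     (if n \<le> 1 then 1
      else if odd n then
        (2 * (ratfun_X + of_nat n) * P_seq n
          + (2 * ratfun_X + of_nat n) * ratfun_shift (P_seq n)
          + (4 * ratfun_X + of_nat n) * ell n) / (4 * (2 * ratfun_X + of_nat n))
      else
        (4 * (ratfun_X + of_nat n) * P_seq n
          + 2 * (2 * ratfun_X + of_nat n + 1) * ratfun_shift (P_seq n)
          + (4 * ratfun_X + of_nat n) * ell (n - 1)) / 4)"

lemma of_nat_ratfun: "(of_nat n :: 'a :: field_char_0 ratfun) = to_fract [:of_nat n:]"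
  by (induction n) (simp_all flip: to_fract_1 to_fract_add add: one_pCons)

lemma four_ratfun_nonzero: "(4 :: 'a :: field_char_0 ratfun) \<noteq> 0"
proof -
  have "(4 :: 'a ratfun) = to_fract [:4:]"
    using of_nat_ratfun[of 4, where ?'a = 'a] by simp
  then show ?thesis
    by (metis pCons_eq_0_iff to_fract_0 to_fract_eq_iff zero_neq_numeral)
qed

lemma two_X_plus_nonzero: "2 * ratfun_X + (of_nat n :: 'a :: field_char_0 ratfun) \<noteq> 0"
proof -
  have two: "(2 :: 'a ratfun) = to_fract [:2:]"
    using of_nat_ratfun[of 2, where ?'a = 'a] by simp
  have "2 * ratfun_X + (of_nat n :: 'a ratfun) = to_fract ([:2:] * [:0, 1:] + [:of_nat n:])"
    by (simp only: two of_nat_ratfun ratfun_X_def to_fract_mult to_fract_add)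
  also have "[:2:] * [:0, 1:] + [:of_nat n:] = ([:of_nat n, 2:] :: 'a poly)"
    by simp
  finally show ?thesis
    by (metis pCons_eq_0_iff to_fract_0 to_fract_eq_iff zero_neq_numeral)
qed

lemma P_seq_1: "P_seq 1 = 1"
  by simp

lemma P_seq_2: "P_seq 2 = 1"
  by (simp add: numeral_2_eq_2)

lemma P_seq_odd:
  assumes "n \<ge> 2" "odd n"
  shows "4 * (2 * ratfun_X + of_nat n) * (P_seq (n + 1) :: 'a :: field_char_0 ratfun) =
    2 * (ratfun_X + of_nat n) * P_seq n
      + (2 * ratfun_X + of_nat n) * ratfun_shift (P_seq n)
      + (4 * ratfun_X + of_nat n) * ell n"
proof -
  have "4 * (2 * ratfun_X + of_nat n :: 'a ratfun) \<noteq> 0"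
    by (simp only: mult_eq_0_iff four_ratfun_nonzero two_X_plus_nonzero simp_thms)
  then show ?thesis
    using assms by (simp del: distrib_left_numeral)
qed

lemma P_seq_even:
  assumes "n \<ge> 2" "even n"
  shows "4 * (P_seq (n + 1) :: 'a :: field_char_0 ratfun) =
    4 * (ratfun_X + of_nat n) * P_seq n
      + 2 * (2 * ratfun_X + of_nat n + 1) * ratfun_shift (P_seq n)
      + (4 * ratfun_X + of_nat n) * ell (n - 1)"
  using assms four_ratfun_nonzero[where 'a = 'a] by simp

end

theory Submission
  imports Defs
begin

text \<open>
  The polynomials have explicit expansions in rising factorials \<open>(x)\<^sub>k\<close>:
  \<open>P_{2m+2}(x) = \<Sum>k\<le>m. a\<^sub>k (x)\<^sub>k\<close> and \<open>P_{2m+1}(x) = \<Sum>k\<le>m. b\<^sub>k (x)\<^sub>k\<close> with integer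
  coefficients \<open>a\<^sub>k = 4^(m-k) (m-k)! binom(2m+1-k, k)\<close> and
  \<open>b\<^sub>k = (2m+1) / (2m+1-k) a\<^sub>k\<close>, which were found by interpolating \<open>P_n\<close> at \<open>0, -1, \<dots>, -m\<close>.
  After substitution of these sums, both recurrences telescope: the partial sums up to \<open>k = M\<close>
  are multiples of \<open>(x+1)\<^sub>M\<close>, and at \<open>M = m\<close> they produce the inhomogeneous term, since
  \<open>\<ell>_{2m+1}(x) = (x+1)\<^sub>m\<close>.
\<close>

definition even_coeff :: "nat \<Rightarrow> nat \<Rightarrow> int" where
  "even_coeff m k = 4 ^ (m - k) * fact (m - k) * int ((2 * m + 1 - k) choose k)"

text \<open>
  The last factor is the Lucas-type number \<open>(2m+1) / (2m+1-k) binom(2m+1-k, k)\<close>, written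
  without division and with the correct value at \<open>k = 0\<close>.
\<close>

definition odd_coeff :: "nat \<Rightarrow> nat \<Rightarrow> int" where
  "odd_coeff m k = 4 ^ (m - k) * fact (m - k) *
     (2 * int ((2 * m + 1 - k) choose k) - int ((2 * m - k) choose k))"

text \<open>The upper limit is independent of the coefficients, so that partial sums make sense for
  the telescoping. The argument lies in any commutative ring because it will be the polynomial
  \<open>[:0, 1:]\<close> or its shift.\<close>

definition rising_sum :: "(nat \<Rightarrow> int) \<Rightarrow> nat \<Rightarrow> 'a :: comm_ring_1 \<Rightarrow> 'a" where
  "rising_sum c M x = (\<Sum>k\<le>M. of_int (c k) * pochhammer x k)"

lemma rising_sum_0 [simp]: "rising_sum c 0 x = of_int (c 0)"
  by (simp add: rising_sum_def)

lemma rising_sum_Suc [simp]: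
  "rising_sum c (Suc M) x = rising_sum c M x + of_int (c (Suc M)) * pochhammer x (Suc M)"
  by (simp add: rising_sum_def)

section \<open>Relations between neighbouring coefficients\<close>

lemma even_coeff_Suc:
  assumes "k < m"
  shows "2 * (int k + 1) * (2 * int m + 1 - int k) * even_coeff m (Suc k) =
    (2 * int m + 1 - 2 * int k) * even_coeff m k"
proof -
  obtain j where m: "m = k + Suc j"
    using assms less_imp_Suc_add by auto
  \<comment> \<open>With m = k + j + 1, \<open>G\<close> and \<open>F\<close> are the binomials in
    the coefficients at k + 1 and k. Absorption links them along the chain \<open>G\<close>,
    \<open>C\<close>, \<open>D\<close>, \<open>F\<close>.\<close>
  define C where "C = int ((2 * j + k + 1) choose k)"
  define D where "D = int ((2 * j + k + 2) choose k)"
  define F where "F = int ((2 * j + k + 3) choose k)"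
  define G where "G = int ((2 * j + k + 2) choose Suc k)"
  have G: "(int k + 1) * G = (2 * int j + int k + 2) * C"
    using Suc_times_binomial_eq[of "2 * j + k + 1" k, THEN arg_cong, of int]
    by (simp add: C_def G_def algebra_simps)
  have D: "(2 * int j + 2) * D = (2 * int j + int k + 2) * C"
    using binomial_absorb_comp[of "2 * j + k + 2" k, THEN arg_cong, of int]
    by (simp add: C_def D_def algebra_simps)
  have F: "(2 * int j + 3) * F = (2 * int j + int k + 3) * D"
    using binomial_absorb_comp[of "2 * j + k + 3" k, THEN arg_cong, of int]
    by (simp add: F_def D_def algebra_simps)
  have *: "(int k + 1) * (2 * int j + int k + 3) * G = (2 * int j + 2) * (2 * int j + 3) * F"
    using G D F by algebra
  have i1: "2 * m + 1 - Suc k = 2 * j + k + 2" and i2: "2 * m + 1 - k = 2 * j + k + 3"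
    and i3: "m - Suc k = j" and i4: "m - k = Suc j"
    using m by auto
  have a1: "even_coeff m (Suc k) = 4 ^ j * fact j * G"
    unfolding even_coeff_def i1 i3 G_def by simp
  have a2: "even_coeff m k = 4 * 4 ^ j * ((int j + 1) * fact j) * F"
    unfolding even_coeff_def i2 i4 F_def by (simp add: algebra_simps)
  have "2 * (int k + 1) * (2 * int m + 1 - int k) * even_coeff m (Suc k) =
      2 * 4 ^ j * fact j * ((int k + 1) * (2 * int j + int k + 3) * G)"
    unfolding a1 by (simp add: m algebra_simps)
  also have "\<dots> = (2 * int m + 1 - 2 * int k) * even_coeff m k"
    unfolding * a2 by (simp add: m algebra_simps)
  finally show ?thesis .
qed

text \<open>For the two binomials C and D in \<open>odd_coeff\<close>, absorption gives (2m+1-2k) C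
  = (2m+1-k) D, hence (2m+1-k)(2C - D) = (2m+1) C.\<close>

lemma odd_coeff_eq:
  assumes "k \<le> m"
  shows "(2 * int m + 1 - int k) * odd_coeff m k = (2 * int m + 1) * even_coeff m k"
proof -
  obtain j where m: "m = k + j"
    using assms le_Suc_ex by auto
  define C where "C = int ((2 * j + k + 1) choose k)"
  define D where "D = int ((2 * j + k) choose k)"
  have "(2 * int j + 1) * C = (2 * int j + int k + 1) * D"
    using binomial_absorb_comp[of "2 * j + k + 1" k, THEN arg_cong, of int]
    by (simp add: C_def D_def algebra_simps)
  then have *: "(2 * int j + int k + 1) * (2 * C - D) = (2 * int j + 2 * int k + 1) * C"
    by algebra
  have i: "2 * m + 1 - k = 2 * j + k + 1" "2 * m - k = 2 * j + k" "m - k = j"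
    using m by auto
  have a: "even_coeff m k = 4 ^ j * fact j * C"
    and b: "odd_coeff m k = 4 ^ j * fact j * (2 * C - D)"
    unfolding even_coeff_def odd_coeff_def i C_def D_def by simp_all
  have "(2 * int m + 1 - int k) * odd_coeff m k =
      4 ^ j * fact j * ((2 * int j + int k + 1) * (2 * C - D))"
    unfolding b by (simp add: m algebra_simps)
  also have "\<dots> = (2 * int m + 1) * even_coeff m k"
    unfolding * a by (simp add: m algebra_simps)
  finally show ?thesis .
qed

text \<open>Applying \<open>odd_coeff_eq\<close> at k and k + 1 reduces this to
  \<open>even_coeff_Suc\<close>; the factor 2m+1-k, positive for k < m, cancels.\<close>

lemma odd_coeff_Suc:
  assumes "k < m"
  shows "2 * (int k + 1) * (2 * int m - int k) * odd_coeff m (Suc k) =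
    (2 * int m + 1 - 2 * int k) * odd_coeff m k"
proof -
  have "(2 * int m + 1 - int k) * (2 * (int k + 1) * (2 * int m - int k) * odd_coeff m (Suc k)) =
     (2 * int m + 1) * (2 * (int k + 1) * (2 * int m + 1 - int k) * even_coeff m (Suc k))"
    using odd_coeff_eq[of "Suc k" m] assms by simp
  also have "\<dots> = (2 * int m + 1 - 2 * int k) * ((2 * int m + 1) * even_coeff m k)"
    unfolding even_coeff_Suc[OF assms] by simp
  also have "\<dots> = (2 * int m + 1 - int k) * ((2 * int m + 1 - 2 * int k) * odd_coeff m k)"
    using odd_coeff_eq[of k m] assms by simp
  finally show ?thesis
    using assms by simp
qed

text \<open>Powers and factorials agree since (m+1) - (k+1) = m - k. With M = 2m+1-k, Pascal's rule
  turns the remaining bracket into binom(M+1, k+1) + binom(M, k), and absorption yields the factor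
  (M+1) + (k+1) = 2m+3.\<close>

lemma odd_coeff_Suc_Suc:
  assumes "k \<le> m"
  shows "(int k + 1) * odd_coeff (Suc m) (Suc k) = (2 * int m + 3) * even_coeff m k"
proof -
  define M where "M = 2 * m + 1 - k"
  have i: "2 * Suc m + 1 - Suc k = Suc M" "2 * Suc m - Suc k = M" "Suc m - Suc k = m - k"
    "2 * m + 1 - k = M" and M: "int M = 2 * int m + 1 - int k"
    using assms unfolding M_def by auto
  have "(int k + 1) * int (Suc M choose Suc k) = (int M + 1) * int (M choose k)"
    using Suc_times_binomial_eq[of M k, THEN arg_cong, of int] by (simp add: algebra_simps)
  moreover have "int (Suc M choose Suc k) = int (M choose k) + int (M choose Suc k)"
    by simp
  ultimately have *: "(int k + 1) * (2 * int (Suc M choose Suc k) - int (M choose Suc k)) =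
      (2 * int m + 3) * int (M choose k)"
    unfolding M by algebra
  show ?thesis
    unfolding odd_coeff_def even_coeff_def i
    using arg_cong[OF *, of "(*) (4 ^ (m - k) * fact (m - k))"] by (simp only: mult_ac)
qed

text \<open>Split 2m+3 = (2m+1-2k) + 2(k+1) in \<open>odd_coeff_Suc_Suc\<close>;
  \<open>even_coeff_Suc\<close> makes the first part a multiple of k + 1 too, so k + 1
  cancels.\<close>

lemma odd_coeff_Suc_eq:
  assumes "k < m"
  shows "odd_coeff (Suc m) (Suc k) =
    2 * (2 * int m + 1 - int k) * even_coeff m (Suc k) + 2 * even_coeff m k"
proof -
  have "(int k + 1) * odd_coeff (Suc m) (Suc k) =
     (int k + 1) * (2 * (2 * int m + 1 - int k) * even_coeff m (Suc k) + 2 * even_coeff m k)"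
    using odd_coeff_Suc_Suc[of k m] even_coeff_Suc[of k m] assms by simp algebra
  then show ?thesis
    by simp
qed

lemma even_coeff_self: "even_coeff m m = int m + 1"
  by (simp add: even_coeff_def)

lemma odd_coeff_self: "odd_coeff m m = 2 * int m + 1"
  by (simp add: odd_coeff_def)

lemma even_coeff_0_right: "even_coeff m 0 = 4 ^ m * fact m"
  by (simp add: even_coeff_def)

lemma odd_coeff_0_right: "odd_coeff m 0 = 4 ^ m * fact m"
  by (simp add: odd_coeff_def)

section \<open>Telescoping of the two recurrences\<close>

lemma pochhammer_shift_mult:
  fixes x :: "'a :: comm_ring_1"
  shows "pochhammer x (Suc k) = x * pochhammer (x + 1) k"
    "pochhammer (x + 1) (Suc k) = (x + 1 + of_nat k) * pochhammer (x + 1) k"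
  by (rule pochhammer_rec, rule pochhammer_rec')

text \<open>The extra factor n allows \<open>odd_coeff_eq\<close> to be used as n a_k = (n-k) b_k,
  which eliminates the even coefficients without division.\<close>

lemma odd_step_partial:
  fixes x :: "'a :: comm_ring_1" and m :: nat
  defines "n \<equiv> 2 * int m + 1"
  assumes "M \<le> m"
  shows "of_int n * (4 * (2 * x + of_int n) * rising_sum (even_coeff m) M x
      - 2 * (x + of_int n) * rising_sum (odd_coeff m) M x
      - (2 * x + of_int n) * rising_sum (odd_coeff m) M (x + 1)) =
    of_int ((n - 2 * int M) * odd_coeff m M) * (4 * x + of_int n) * pochhammer (x + 1) M"
  using assms(2)
proof (induction M)
  case 0
  then show ?case
    by (simp add: even_coeff_0_right odd_coeff_0_right algebra_simps)
next
  case (Suc M)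
  define K where "K = int (Suc M)"
  define a b where "a = even_coeff m (Suc M)" and "b = odd_coeff m (Suc M)"
  define E where "E = pochhammer (x + 1) M"
  define A B C where "A = rising_sum (even_coeff m) M x"
    and "B = rising_sum (odd_coeff m) M x" and "C = rising_sum (odd_coeff m) M (x + 1)"
  \<comment> \<open>This expresses the right side of the induction hypothesis through the new
    coefficient, so that \<open>b'\<close> and \<open>E\<close> become common factors.\<close>
  have b: "(n - 2 * int M) * odd_coeff m M = 2 * K * (n - K) * b"
    using odd_coeff_Suc[of M m] Suc.prems by (simp add: b_def n_def K_def algebra_simps)
  \<comment> \<open>Names for the images in the ring keep the polynomial computation free of
    casts.\<close>
  obtain N k a' b' :: 'a where ring:
    "N = of_int n" "k = of_int K" "a' = of_int a" "b' = of_int b"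
    by blast
  have "of_int (n * a) = (of_int ((n - K) * b) :: 'a)"
    using odd_coeff_eq[OF Suc.prems] by (simp add: a_def b_def n_def K_def algebra_simps)
  then have a': "N * a' = (N - k) * b'"
    by (simp add: ring)
  have IH: "N * (4 * (2 * x + N) * A - 2 * (x + N) * B - (2 * x + N) * C) =
      2 * k * (N - k) * b' * (4 * x + N) * E"
    using Suc.IH Suc.prems by (simp add: b ring A_def B_def C_def E_def)
  have K: "x + 1 + of_nat M = x + k"
    by (simp add: ring K_def)
  have "N * (4 * (2 * x + N) * (A + a' * (x * E)) - 2 * (x + N) * (B + b' * (x * E))
        - (2 * x + N) * (C + b' * ((x + k) * E))) =
      N * (4 * (2 * x + N) * A - 2 * (x + N) * B - (2 * x + N) * C)
      + (4 * (2 * x + N) * x * (N * a') - 2 * (x + N) * x * N * b' - (2 * x + N) * (x + k) * N * b') * E"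
    by (simp add: algebra_simps)
  also have "\<dots> = (N - 2 * k) * b' * (4 * x + N) * ((x + k) * E)"
    unfolding IH a' by (simp add: algebra_simps)
  finally show ?case
    unfolding rising_sum_Suc pochhammer_shift_mult(1)[of x] pochhammer_shift_mult(2) K
      A_def[symmetric] B_def[symmetric] C_def[symmetric] a_def[symmetric] b_def[symmetric]
      E_def[symmetric] K_def[symmetric]
    by (simp add: ring)
qed

lemma even_step_partial:
  fixes x :: "'a :: comm_ring_1" and m :: nat
  defines "n \<equiv> 2 * int m + 2"
  assumes "M \<le> m"
  shows "4 * rising_sum (odd_coeff (Suc m)) M x
      - 4 * (x + of_int n) * rising_sum (even_coeff m) M x
      - 2 * (2 * x + of_int n + 1) * rising_sum (even_coeff m) M (x + 1) =
    of_int (even_coeff m M) * (2 * of_int n - 2 - 4 * of_nat M - 8 * x) * pochhammer (x + 1) M"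
  using assms(2)
proof (induction M)
  case 0
  then show ?case
    by (simp add: even_coeff_0_right odd_coeff_0_right n_def algebra_simps)
next
  case (Suc M)
  define K where "K = int (Suc M)"
  define a a0 b where "a = even_coeff m (Suc M)" and "a0 = even_coeff m M"
    and "b = odd_coeff (Suc m) (Suc M)"
  define E where "E = pochhammer (x + 1) M"
  define A B C where "A = rising_sum (odd_coeff (Suc m)) M x"
    and "B = rising_sum (even_coeff m) M x" and "C = rising_sum (even_coeff m) M (x + 1)"
  obtain N k a' a0' b' :: 'a where ring:
    "N = of_int n" "k = of_int K" "a' = of_int a" "a0' = of_int a0" "b' = of_int b"
    by blast
  have "(n + 1 - 2 * K) * a0 = 2 * K * (n - K) * a"
    using even_coeff_Suc[of M m] Suc.prems
    by (simp add: a_def a0_def n_def K_def algebra_simps)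
  then have "of_int (2 * ((n + 1 - 2 * K) * a0)) = (of_int (2 * (2 * K * (n - K) * a)) :: 'a)"
    by simp
  then have a: "(2 * N + 2 - 4 * k) * a0' = 4 * k * (N - k) * a'"
    by (simp add: ring algebra_simps)
  have "b = 2 * (n - K) * a + 2 * a0"
    using odd_coeff_Suc_eq[of M m] Suc.prems
    by (simp add: a_def a0_def b_def n_def K_def algebra_simps)
  then have b: "b' = 2 * (N - k) * a' + 2 * a0'"
    by (simp add: ring)
  have IH: "4 * A - 4 * (x + N) * B - 2 * (2 * x + N + 1) * C =
      a0' * (2 * N + 2 - 4 * k - 8 * x) * E"
    using Suc.IH Suc.prems by (simp add: ring A_def B_def C_def E_def a0_def K_def algebra_simps)
  have K: "x + 1 + of_nat M = x + k" "of_nat (Suc M) = k"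
    by (simp_all add: ring K_def)
  have "4 * (A + b' * (x * E)) - 4 * (x + N) * (B + a' * (x * E))
        - 2 * (2 * x + N + 1) * (C + a' * ((x + k) * E)) =
      (4 * A - 4 * (x + N) * B - 2 * (2 * x + N + 1) * C)
      + (4 * b' * x - 4 * (x + N) * a' * x - 2 * (2 * x + N + 1) * a' * (x + k)) * E"
    by (simp add: algebra_simps)
  \<comment> \<open>The term -8x \<open>a0'\<close> from the induction hypothesis cancels against
    the 2 \<open>a0'\<close> inside \<open>b'\<close>, multiplied by 4x. What is left of
    \<open>a0'\<close> is exactly what fact \<open>a\<close> converts into
    \<open>a'\<close>.\<close>
  also have "\<dots> = (2 * N + 2 - 4 * k) * a0' * E
      + (8 * (N - k) * x - 4 * (x + N) * x - 2 * (2 * x + N + 1) * (x + k)) * a' * E"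
    unfolding IH b by (simp add: algebra_simps)
  also have "\<dots> = a' * (2 * N - 2 - 4 * k - 8 * x) * ((x + k) * E)"
    unfolding a by (simp add: algebra_simps)
  finally show ?case
    unfolding rising_sum_Suc pochhammer_shift_mult(1)[of x] pochhammer_shift_mult(2) K
      A_def[symmetric] B_def[symmetric] C_def[symmetric] a_def[symmetric] b_def[symmetric]
      E_def[symmetric] ring .
qed

text \<open>At M = m the factor (n - 2m) b_m equals n, so the auxiliary n cancels in an integral
  domain of characteristic 0.\<close>

lemma odd_step:
  fixes x :: "'a :: {idom, ring_char_0}" and m :: nat
  defines "n \<equiv> of_nat (2 * m + 1)"
  shows "4 * (2 * x + n) * rising_sum (even_coeff m) m x =
    2 * (x + n) * rising_sum (odd_coeff m) m x
      + (2 * x + n) * rising_sum (odd_coeff m) m (x + 1)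
      + (4 * x + n) * pochhammer (x + 1) m"
proof -
  have n: "n = of_int (2 * int m + 1)"
    by (simp add: n_def)
  have "n \<noteq> 0"
    unfolding n_def of_nat_eq_0_iff by simp
  moreover have "n * (4 * (2 * x + n) * rising_sum (even_coeff m) m x
      - 2 * (x + n) * rising_sum (odd_coeff m) m x
      - (2 * x + n) * rising_sum (odd_coeff m) m (x + 1)) =
      n * ((4 * x + n) * pochhammer (x + 1) m)"
    using odd_step_partial[of m m x] unfolding odd_coeff_self n[symmetric]
    by (simp add: n mult.assoc)
  ultimately show ?thesis
    by (simp only: mult_cancel_left) (simp add: algebra_simps)
qed

text \<open>The odd sum has one more term, contributing 4(2m+3) x (x+1)_m. Added to the partial-sum
  value (m+1)(2-8x)(x+1)_m, it gives (4x+n)(x+1)_m.\<close>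

lemma even_step:
  fixes x :: "'a :: comm_ring_1" and m :: nat
  defines "n \<equiv> of_nat (2 * m + 2)"
  shows "4 * rising_sum (odd_coeff (Suc m)) (Suc m) x =
    4 * (x + n) * rising_sum (even_coeff m) m x
      + 2 * (2 * x + n + 1) * rising_sum (even_coeff m) m (x + 1)
      + (4 * x + n) * pochhammer (x + 1) m"
proof -
  have n: "of_int (2 * int m + 2) = n" "n = 2 * of_nat m + 2"
    by (simp_all add: n_def)
  show ?thesis
    using even_step_partial[of m m x]
    unfolding n(1) rising_sum_Suc pochhammer_shift_mult(1) odd_coeff_self even_coeff_self
    by (simp add: n(2) algebra_simps)
qed

section \<open>Composition, degree and integrality of rising-factorial sums\<close>

lemma pcompose_rising_sum:
  fixes p q :: "'a :: comm_ring_1 poly"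
  shows "pcompose (rising_sum c M p) q = rising_sum c M (pcompose p q)"
proof -
  have "pcompose (of_nat k) q = of_nat k" "pcompose (of_int i) q = of_int i" for k i
    by (simp_all add: of_nat_poly of_int_poly)
  then show ?thesis
    by (simp add: rising_sum_def pcompose_sum pcompose_mult pochhammer_prod pcompose_prod
        pcompose_add)
qed

lemma coeff_pochhammer_X_Ints:
  "coeff (pochhammer [:0, 1 :: 'a :: comm_ring_1:] k) i \<in> \<int>"
proof (induction k arbitrary: i)
  case 0
  then show ?case
    by (simp add: coeff_1)
next
  case (Suc k)
  have "pochhammer [:0, 1 :: 'a:] (Suc k) =
      pochhammer [:0, 1:] k * [:of_nat k, 1:]"
    by (simp add: pochhammer_Suc of_nat_poly)
  then show ?case
    using Suc.IH by (auto simp: coeff_pCons split: nat.split)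
qed

lemma pochhammer_X_neq_0: "pochhammer [:0, 1 :: 'a :: idom:] k \<noteq> 0"
  by (simp add: pochhammer_prod of_nat_poly)

lemma degree_pochhammer_X: "degree (pochhammer [:0, 1 :: 'a :: idom:] k) = k"
  by (simp add: pochhammer_prod degree_prod_eq_sum_degree of_nat_poly)

lemma degree_rising_sum_X:
  assumes "c M \<noteq> 0"
  shows "degree (rising_sum c M [:0, 1 :: 'a :: {idom, ring_char_0}:]) = M"
proof (cases M)
  case (Suc N)
  have "degree (of_int (c k) * pochhammer [:0, 1 :: 'a:] k) \<le> k" for k
    by (metis degree_mult_le degree_of_int degree_pochhammer_X add_0)
  then have "degree (rising_sum c N [:0, 1 :: 'a:]) \<le> N"
    unfolding rising_sum_def by (intro degree_sum_le) (auto intro: order_trans)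
  moreover have "degree (of_int (c M) * pochhammer [:0, 1 :: 'a:] M) = M"
    using assms by (subst degree_mult_eq) (auto simp: degree_pochhammer_X pochhammer_X_neq_0)
  ultimately show ?thesis
    using Suc by (simp add: degree_add_eq_right del: pochhammer_Suc)
qed simp

lemma coeff_rising_sum_X_Ints:
  "coeff (rising_sum c M [:0, 1 :: 'a :: comm_ring_1:]) i \<in> \<int>"
  by (auto simp: rising_sum_def coeff_sum of_int_poly coeff_pochhammer_X_Ints)

section \<open>Identification of the sequence\<close>

lemma ell_eq_pochhammer:
  "ell (2 * m + 1) = to_fract (pochhammer ([:0, 1:] + 1 :: 'a :: field_char_0 poly) m)"
proof -
  have nat: "to_fract (of_nat k :: 'a poly) = of_nat k" for k
    by (simp add: of_nat_poly of_nat_ratfun)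
  have "(\<Prod>j = 1..m. ratfun_X + of_nat j) =
      to_fract (pochhammer ([:0, 1:] + 1 :: 'a poly) m)"
    by (induction m)
       (simp_all add: pochhammer_Suc ratfun_X_def add_ac
         del: to_fract_mult flip: nat to_fract_add to_fract_mult)
  then show ?thesis
    by (simp add: ell_def)
qed

text \<open>The induction carries consecutive pairs: \<open>even_step\<close> leads from index 2m+2
  to 2m+3, and \<open>odd_step\<close> from there to 2m+4.\<close>

lemma P_seq_rising_sum:
  "P_seq (2 * m + 1) = to_fract (rising_sum (odd_coeff m) m [:0, 1 :: 'a :: field_char_0:]) \<and>
   P_seq (2 * m + 2) = to_fract (rising_sum (even_coeff m) m [:0, 1 :: 'a:])"
proof (induction m)
  case 0
  then show ?case
    by (simp add: odd_coeff_self even_coeff_self)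
next
  case (Suc m)
  define X :: "'a poly" where "X = [:0, 1:]"
  have num: "to_fract (numeral k :: 'a poly) = numeral k" for k
    by (metis of_nat_numeral of_nat_poly of_nat_ratfun)
  have nat: "to_fract (of_nat k :: 'a poly) = of_nat k" for k
    by (simp add: of_nat_poly of_nat_ratfun)
  have shift: "pcompose X [:1, 1:] = X + 1"
    by (simp add: X_def one_pCons pcompose_pCons)
  have "4 * P_seq (2 * m + 2 + 1) =
      to_fract (4 * rising_sum (odd_coeff (Suc m)) (Suc m) X)"
    using P_seq_even[of "2 * m + 2", where ?'a = 'a] Suc.IH ell_eq_pochhammer[of m, where ?'a = 'a]
    unfolding even_step
    by (simp add: ratfun_shift_to_fract pcompose_rising_sum shift num nat X_def[symmetric] ratfun_X_def
        del: P_seq.simps of_nat_add of_nat_mult of_nat_Suc rising_sum_Suc)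
  then have odd: "P_seq (2 * Suc m + 1) = to_fract (rising_sum (odd_coeff (Suc m)) (Suc m) X)"
    using four_ratfun_nonzero[where ?'a = 'a] by (simp add: num del: P_seq.simps rising_sum_Suc)
  let ?n = "2 * Suc m + 1"
  \<comment> \<open>This is the step that could create a denominator: \<open>odd_step\<close>
    exhibits the right side of the recurrence as an exact multiple of 4(2x+n).\<close>
  have "4 * (2 * ratfun_X + of_nat ?n) * P_seq (?n + 1) =
      to_fract (4 * (2 * X + of_nat ?n) * rising_sum (even_coeff (Suc m)) (Suc m) X)"
    using P_seq_odd[of ?n, where ?'a = 'a] odd ell_eq_pochhammer[of "Suc m", where ?'a = 'a]
    unfolding odd_step
    by (simp add: ratfun_shift_to_fract pcompose_rising_sum shift num nat X_def[symmetric] ratfun_X_def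
        del: P_seq.simps of_nat_add of_nat_mult of_nat_Suc rising_sum_Suc pochhammer_Suc mult_Suc_right)
  then have "4 * (2 * ratfun_X + of_nat ?n) * P_seq (?n + 1) =
      4 * (2 * ratfun_X + of_nat ?n) * to_fract (rising_sum (even_coeff (Suc m)) (Suc m) X)"
    by (simp only: to_fract_mult to_fract_add num nat X_def ratfun_X_def)
  then have "P_seq (?n + 1) = to_fract (rising_sum (even_coeff (Suc m)) (Suc m) X)"
    using two_X_plus_nonzero[of ?n, where ?'a = 'a] four_ratfun_nonzero[where ?'a = 'a]
    by (simp only: mult_cancel_left mult_eq_0_iff simp_thms)
  with odd show ?case
    by (simp add: X_def del: P_seq.simps rising_sum_Suc)
qed

theorem theorem2:
  fixes n :: nat
  assumes "n \<ge> 1"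
  shows "\<exists>p :: 'a :: field_char_0 poly.
    P_seq n = to_fract p \<and> degree p = (n - 1) div 2 \<and> (\<forall>i. coeff p i \<in> \<int>)"
proof -
  define m where "m = (n - 1) div 2"
  consider "n = 2 * m + 1" | "n = 2 * m + 2"
    using assms unfolding m_def by linarith
  \<comment> \<open>The leading coefficients are 2m+1 and m+1, so the degree is exactly m in both
    cases.\<close>
  then obtain c where c: "P_seq n = to_fract (rising_sum c m [:0, 1 :: 'a:])" "c m \<noteq> 0"
  proof cases
    case 1
    then show ?thesis
      using that[of "odd_coeff m"] P_seq_rising_sum[of m, where ?'a = 'a]
      by (simp add: odd_coeff_self del: P_seq.simps)
  next
    case 2
    then show ?thesis
      using that[of "even_coeff m"] P_seq_rising_sum[of m, where ?'a = 'a]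
      by (simp add: even_coeff_self del: P_seq.simps)
  qed
  then show ?thesis
    using degree_rising_sum_X[of c m] coeff_rising_sum_X_Ints[of c m] unfolding m_def by blast
qed

end
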